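(* Let $K_5$ be the complete graph on vertex set $[5]$. Then the abelian group $H_1(K_5;\mathbb Z)$ contains an element of order $2$ (i.e. it has $\mathbb Z_2$-torsion).
   Context: Let $G$ be a simple graph with vertex set $[n]$; an edge $\{i,j\}$ with $i<j$ is written $(i,j)$, and $E(G)$ is totally ordered lexicographically. For $F\subseteq E(G)$ let $\beta(F)$ be the partition of $[n]$ into the vertex sets of the connected components of $([n],F)$, and $\mathfrak S_{\beta(F)}\subseteq\mathfrak S_n$ the subgroup of permutations mapping each block to itself. For a commutative ring $R$ let $a_F=\sum_{\sigma\in\mathfrak S_{\beta(F)}}\sigma\in R[\mathfrak S_n]$ and $\mathcal M_F=R[\mathfrak S_n]a_F$; for $e\in F$, $\mathcal M_F\subseteq\mathcal M_{F\setminus e}$. The chain complex is $C_i(G;R)=\bigoplus_{|F|=i}\mathcal M_F$ with $d_i(x)=\sum_{e\in F}(-1)^{|\{f\in F: f<e\}|}\iota_{F,F\setminus e}(x)$ for $x\in\mathcal M_F$, $\iota$ the inclusion into the summand $\mathcal M_{F\setminus e}$; $H_i(G;R)=\ker d_i/\operatorname{im}d_{i+1}$ (the $q$-degree zero chromatic symmetric homology). *)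

theory Defs
  imports "HOL-Combinatorics.Permutations"
begin

text \<open>Vertices are 1..n; an edge (i,j) with i<j is a pair of naturals; a graph is its edge set.\<close>

definition complete_graph :: "nat \<Rightarrow> (nat \<times> nat) set" where
  "complete_graph n = {(i, j). 1 \<le> i \<and> i < j \<and> j \<le> n}"

definition edge_less :: "nat \<times> nat \<Rightarrow> nat \<times> nat \<Rightarrow> bool" where
  "edge_less f e \<longleftrightarrow> fst f < fst e \<or> (fst f = fst e \<and> snd f < snd e)"

definition conn_rel :: "nat \<Rightarrow> (nat \<times> nat) set \<Rightarrow> (nat \<times> nat) set" where
  "conn_rel n F = ({1..n} \<times> {1..n}) \<inter> (F \<union> F\<inverse>)\<^sup>*"

definition beta :: "nat \<Rightarrow> (nat \<times> nat) set \<Rightarrow> nat set set" where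
  "beta n F = {1..n} // conn_rel n F"

definition perms :: "nat \<Rightarrow> (nat \<Rightarrow> nat) set" where
  "perms n = {\<sigma>. \<sigma> permutes {1..n}}"

definition young_sub :: "nat \<Rightarrow> (nat \<times> nat) set \<Rightarrow> (nat \<Rightarrow> nat) set" where
  "young_sub n F = {\<sigma> \<in> perms n. \<forall>B \<in> beta n F. \<sigma> ` B = B}"

definition grp_ring :: "nat \<Rightarrow> ((nat \<Rightarrow> nat) \<Rightarrow> 'r::comm_ring_1) set" where
  "grp_ring n = {x. \<forall>\<sigma>. x \<sigma> \<noteq> 0 \<longrightarrow> \<sigma> \<in> perms n}"

definition gmult :: "nat \<Rightarrow> ((nat \<Rightarrow> nat) \<Rightarrow> 'r::comm_ring_1) \<Rightarrow> ((nat \<Rightarrow> nat) \<Rightarrow> 'r) \<Rightarrow> ((nat \<Rightarrow> nat) \<Rightarrow> 'r)" where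
  "gmult n x y = (\<lambda>\<tau>. if \<tau> \<in> perms n
      then (\<Sum>\<sigma>\<in>perms n. x \<sigma> * y (inv \<sigma> \<circ> \<tau>)) else 0)"

definition aF :: "nat \<Rightarrow> (nat \<times> nat) set \<Rightarrow> ((nat \<Rightarrow> nat) \<Rightarrow> 'r::comm_ring_1)" where
  "aF n F = (\<lambda>\<sigma>. if \<sigma> \<in> young_sub n F then 1 else 0)"

definition MF :: "nat \<Rightarrow> (nat \<times> nat) set \<Rightarrow> ((nat \<Rightarrow> nat) \<Rightarrow> 'r::comm_ring_1) set" where
  "MF n F = {gmult n x (aF n F) | x. x \<in> grp_ring n}"

definition chains :: "nat \<Rightarrow> (nat \<times> nat) set \<Rightarrow> nat \<Rightarrow>
    ((nat \<times> nat) set \<Rightarrow> (nat \<Rightarrow> nat) \<Rightarrow> 'r::comm_ring_1) set" where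
  "chains n E i = {c. (\<forall>F \<sigma>. c F \<sigma> \<noteq> 0 \<longrightarrow> F \<subseteq> E \<and> card F = i) \<and> (\<forall>F. c F \<in> MF n F)}"

definition bd :: "nat \<Rightarrow> (nat \<times> nat) set \<Rightarrow> nat \<Rightarrow>
    ((nat \<times> nat) set \<Rightarrow> (nat \<Rightarrow> nat) \<Rightarrow> 'r::comm_ring_1) \<Rightarrow>
    ((nat \<times> nat) set \<Rightarrow> (nat \<Rightarrow> nat) \<Rightarrow> 'r)" where
  "bd n E i c = (\<lambda>F' \<sigma>. if F' \<subseteq> E \<and> card F' + 1 = i then
      (\<Sum>e\<in>E - F'. (-1) ^ card {f \<in> insert e F'. edge_less f e} * c (insert e F') \<sigma>)
    else 0)"

end

theory Submission
  imports Defs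
begin

text \<open>
  The module \<open>M\<^sub>F\<close> consists of the functions on the symmetric group that are invariant under right
  translation by the Young subgroup of \<open>F\<close>. For a two-element set \<open>Q\<close> of vertices let \<open>\<Phi>(x)\<close> be the
  sum of \<open>x\<^sub>e(\<sigma>)\<close> over all edges \<open>e\<close> and all \<open>\<sigma>\<close> with \<open>\<sigma>(e) = Q\<close>. On boundaries \<open>\<Phi>\<close> is divisible by 4:
  the contributions of two adjacent edges \<open>e\<close>, \<open>f\<close> cancel, by right translation with the transposition
  exchanging \<open>e\<close> and \<open>f\<close>, and for disjoint \<open>e\<close>, \<open>f\<close> the Young subgroup has order 4 and acts freely on
  the \<open>\<sigma>\<close> with \<open>\<sigma>(e) = Q\<close>. An explicit cycle \<open>z\<close> has \<open>\<Phi>(z) = 2\<close>, while \<open>2z\<close> is an explicit boundary;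
  both were found by computer among the chains that only depend on the word obtained from \<open>\<sigma>\<close> by
  identifying the values 1, 2 and the values 3, 4.
\<close>

section \<open>Symmetric groups and Young subgroups\<close>

lemma finite_perms: "finite (perms n)"
  unfolding perms_def by (simp add: finite_permutations)

lemma young_sub_subset_perms: "young_sub n F \<subseteq> perms n"
  unfolding young_sub_def by blast

lemma perms_comp: "\<sigma> \<in> perms n \<Longrightarrow> \<tau> \<in> perms n \<Longrightarrow> \<sigma> \<circ> \<tau> \<in> perms n"
  unfolding perms_def by (simp add: permutes_compose)

lemma perms_inv: "\<sigma> \<in> perms n \<Longrightarrow> inv \<sigma> \<in> perms n"
  unfolding perms_def by (simp add: permutes_inv)

lemma perms_inv_o:
  assumes "\<sigma> \<in> perms n"
  shows "inv \<sigma> \<circ> \<sigma> = id" "\<sigma> \<circ> inv \<sigma> = id"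
  using assms unfolding perms_def by (auto intro: permutes_inv_o)

lemma young_sub_id: "id \<in> young_sub n F"
  unfolding young_sub_def perms_def by (simp add: permutes_id)

lemma young_sub_comp:
  assumes "\<sigma> \<in> young_sub n F" "\<tau> \<in> young_sub n F"
  shows "\<sigma> \<circ> \<tau> \<in> young_sub n F"
proof -
  have "(\<sigma> \<circ> \<tau>) ` B = B" if "B \<in> beta n F" for B
    using assms that unfolding young_sub_def image_comp[symmetric] by simp
  moreover have "\<sigma> \<circ> \<tau> \<in> perms n"
    using assms unfolding young_sub_def by (intro perms_comp) auto
  ultimately show ?thesis
    unfolding young_sub_def by blast
qed

lemma young_sub_inv:
  assumes "\<sigma> \<in> young_sub n F"
  shows "inv \<sigma> \<in> young_sub n F"
proof -
  have p: "\<sigma> \<in> perms n" and B: "\<And>B. B \<in> beta n F \<Longrightarrow> \<sigma> ` B = B"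
    using assms unfolding young_sub_def by auto
  have "inv \<sigma> ` B = B" if "B \<in> beta n F" for B
    using B[OF that] perms_inv_o(1)[OF p] by (metis image_comp image_id id_apply)
  then show ?thesis
    using perms_inv[OF p] unfolding young_sub_def by blast
qed

section \<open>The modules \<open>MF n F\<close> as spaces of right-invariant functions\<close>

text \<open>The coefficient of \<open>gmult n y (aF n F)\<close> at \<sigma> is the sum of
  \<open>y\<close> over the \<rho> with \<open>inv \<rho> \<circ> \<sigma>\<close> in the Young
  subgroup, a condition that survives right multiplication of \<sigma> by \<tau>. Outside
  \<open>perms n\<close> both sides are 0.\<close>

lemma MF_right_invariant:
  assumes x: "x \<in> MF n F" and \<tau>: "\<tau> \<in> young_sub n F"
  shows "x (\<sigma> \<circ> \<tau>) = x \<sigma>"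
proof -
  obtain y where y: "x = gmult n y (aF n F)"
    using x unfolding MF_def by blast
  have \<tau>p: "\<tau> \<in> perms n"
    using \<tau> young_sub_subset_perms by blast
  have cancel: "(\<rho> \<circ> \<tau>) \<circ> inv \<tau> = \<rho>" for \<rho>
    using perms_inv_o(2)[OF \<tau>p] by (simp add: comp_assoc)
  have perms: "\<sigma> \<circ> \<tau> \<in> perms n \<longleftrightarrow> \<sigma> \<in> perms n"
    using perms_comp[OF _ \<tau>p] perms_comp[OF _ perms_inv[OF \<tau>p]] cancel by metis
  have young: "\<rho> \<circ> \<tau> \<in> young_sub n F \<longleftrightarrow> \<rho> \<in> young_sub n F" for \<rho>
    using young_sub_comp[OF _ \<tau>] young_sub_comp[OF _ young_sub_inv[OF \<tau>]] cancel by metis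
  have "inv \<rho> \<circ> (\<sigma> \<circ> \<tau>) \<in> young_sub n F \<longleftrightarrow> inv \<rho> \<circ> \<sigma> \<in> young_sub n F" for \<rho>
    using young[of "inv \<rho> \<circ> \<sigma>"] by (simp only: comp_assoc)
  then show ?thesis
    unfolding y gmult_def aF_def perms by simp
qed

text \<open>A right-invariant function is recovered from its restriction to one
  representative per left coset of the Young subgroup.\<close>

lemma right_invariant_in_MF:
  assumes x: "x \<in> grp_ring n"
    and inv: "\<And>\<sigma> \<tau>. \<sigma> \<in> perms n \<Longrightarrow> \<tau> \<in> young_sub n F \<Longrightarrow> x (\<sigma> \<circ> \<tau>) = x \<sigma>"
  shows "x \<in> MF n F"
proof -
  let ?H = "young_sub n F"
  define coset where "coset \<sigma> = (\<lambda>\<tau>. \<sigma> \<circ> \<tau>) ` ?H" for \<sigma> :: "nat \<Rightarrow> nat"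
  \<comment> \<open>The choice is made from the coset as a set, so all elements of one coset share
    their representative.\<close>
  define rep where "rep \<sigma> = (SOME \<rho>. \<rho> \<in> coset \<sigma>)" for \<sigma>
  define y where "y \<sigma> = (if rep \<sigma> = \<sigma> then x \<sigma> else 0)" for \<sigma>
  have self: "\<sigma> \<in> coset \<sigma>" for \<sigma>
    unfolding coset_def using young_sub_id by (metis comp_id image_eqI)
  have rep_in: "rep \<sigma> \<in> coset \<sigma>" for \<sigma>
    unfolding rep_def using self[of \<sigma>] by (rule someI[where P = "\<lambda>\<rho>. \<rho> \<in> coset \<sigma>"])
  have coset_eq: "coset (\<sigma> \<circ> \<tau>) = coset \<sigma>" if \<tau>: "\<tau> \<in> ?H" for \<sigma> \<tau>
  proof
    show "coset (\<sigma> \<circ> \<tau>) \<subseteq> coset \<sigma>"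
      unfolding coset_def using young_sub_comp[OF \<tau>] by (auto simp: comp_assoc)
    show "coset \<sigma> \<subseteq> coset (\<sigma> \<circ> \<tau>)"
    proof
      fix \<rho> assume "\<rho> \<in> coset \<sigma>"
      then obtain \<upsilon> where \<upsilon>: "\<upsilon> \<in> ?H" "\<rho> = \<sigma> \<circ> \<upsilon>"
        unfolding coset_def by blast
      have "\<tau> \<circ> (inv \<tau> \<circ> \<upsilon>) = \<upsilon>"
        using perms_inv_o(2) \<tau> young_sub_subset_perms by (metis comp_assoc id_comp subsetD)
      then have "\<rho> = (\<sigma> \<circ> \<tau>) \<circ> (inv \<tau> \<circ> \<upsilon>)"
        using \<upsilon> by (simp only: comp_assoc)
      then show "\<rho> \<in> coset (\<sigma> \<circ> \<tau>)"
        unfolding coset_def using young_sub_comp[OF young_sub_inv[OF \<tau>] \<upsilon>(1)] by blast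
    qed
  qed
  \<comment> \<open>This turns the support condition in the convolution into membership in the left
    coset of \<tau>.\<close>
  have iff: "inv \<rho> \<circ> \<tau> \<in> ?H \<longleftrightarrow> \<rho> \<in> coset \<tau>" if \<rho>: "\<rho> \<in> perms n" and \<tau>: "\<tau> \<in> perms n" for \<rho> \<tau>
  proof
    assume h: "inv \<rho> \<circ> \<tau> \<in> ?H"
    have "\<rho> \<circ> (inv \<rho> \<circ> \<tau>) = \<tau>"
      using perms_inv_o(2)[OF \<rho>] by (metis comp_assoc id_comp)
    then have "coset \<tau> = coset \<rho>"
      using coset_eq[OF h, of \<rho>] by simp
    then show "\<rho> \<in> coset \<tau>"
      using self by simp
  next
    assume "\<rho> \<in> coset \<tau>"
    then obtain \<upsilon> where \<upsilon>: "\<upsilon> \<in> ?H" "\<rho> = \<tau> \<circ> \<upsilon>"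
      unfolding coset_def by blast
    have \<upsilon>p: "\<upsilon> \<in> perms n"
      using \<upsilon> young_sub_subset_perms by blast
    have "inv \<rho> = inv \<upsilon> \<circ> inv \<tau>"
      unfolding \<upsilon>(2) using \<tau> \<upsilon>p unfolding perms_def
      by (simp add: o_inv_distrib permutes_bij)
    then have "inv \<rho> \<circ> \<tau> = inv \<upsilon>"
      using perms_inv_o(1)[OF \<tau>] by (simp add: comp_assoc)
    then show "inv \<rho> \<circ> \<tau> \<in> ?H"
      using young_sub_inv[OF \<upsilon>(1)] by simp
  qed
  have y_ring: "y \<in> grp_ring n"
    using x unfolding grp_ring_def y_def by auto
  have "gmult n y (aF n F) \<tau> = x \<tau>" for \<tau>
  proof (cases "\<tau> \<in> perms n")
    case True
    have coset_perms: "coset \<tau> \<subseteq> perms n"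
      unfolding coset_def using True perms_comp young_sub_subset_perms by blast
    have rep_const: "rep \<rho> = rep \<tau>" if "\<rho> \<in> coset \<tau>" for \<rho>
      using that coset_eq unfolding coset_def rep_def by fastforce
    have y_coset: "y \<rho> = (if \<rho> = rep \<tau> then x \<tau> else 0)" if \<rho>: "\<rho> \<in> coset \<tau>" for \<rho>
    proof -
      have "x \<rho> = x \<tau>"
        using \<rho> inv[OF True] unfolding coset_def by blast
      then show ?thesis
        using rep_const[OF \<rho>] unfolding y_def by (cases "\<rho> = rep \<tau>") auto
    qed
    \<comment> \<open>Convolution with \<open>aF n F\<close> sums \<open>y\<close> over the coset of
      \<tau>, where only the representative contributes.\<close>
    have "gmult n y (aF n F) \<tau> = (\<Sum>\<rho>\<in>perms n. if \<rho> \<in> coset \<tau> then y \<rho> else 0)"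
      unfolding gmult_def aF_def using True iff by (auto intro!: sum.cong)
    also have "\<dots> = (\<Sum>\<rho>\<in>coset \<tau>. y \<rho>)"
      using coset_perms finite_perms by (simp add: sum.If_cases Int_absorb1)
    also have "\<dots> = (\<Sum>\<rho>\<in>coset \<tau>. if \<rho> = rep \<tau> then x \<tau> else 0)"
      using y_coset by (rule sum.cong[OF refl])
    also have "\<dots> = x \<tau>"
      using rep_in[of \<tau>] finite_subset[OF coset_perms finite_perms] by simp
    finally show ?thesis .
  next
    case False
    then show ?thesis
      using x unfolding gmult_def grp_ring_def by auto
  qed
  then have "x = gmult n y (aF n F)"
    by auto
  then show ?thesis
    unfolding MF_def using y_ring by blast
qed

lemma MF_iff:
  "x \<in> MF n F \<longleftrightarrow> x \<in> grp_ring n \<and>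
     (\<forall>\<sigma>\<in>perms n. \<forall>\<tau>\<in>young_sub n F. x (\<sigma> \<circ> \<tau>) = x \<sigma>)"
proof
  assume x: "x \<in> MF n F"
  then have "x \<in> grp_ring n"
    unfolding MF_def gmult_def grp_ring_def by auto
  with x show "x \<in> grp_ring n \<and> (\<forall>\<sigma>\<in>perms n. \<forall>\<tau>\<in>young_sub n F. x (\<sigma> \<circ> \<tau>) = x \<sigma>)"
    using MF_right_invariant by blast
qed (auto intro: right_invariant_in_MF)

section \<open>Young subgroups and connectivity\<close>

text \<open>Membership in \<open>X\<close> cannot change along an edge, hence not along a path, and
  \<tau> moves each vertex within its component. So \<tau> maps the finite set \<open>X\<close>
  injectively into itself.\<close>

lemma young_sub_image_saturated:
  assumes \<tau>: "\<tau> \<in> young_sub n F" and X: "X \<subseteq> {1..n}"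
    and sat: "\<And>i j. (i, j) \<in> F \<Longrightarrow> i \<in> X \<longleftrightarrow> j \<in> X"
  shows "\<tau> ` X = X"
proof -
  have "\<tau> i \<in> X" if i: "i \<in> X" for i
  proof -
    have "i \<in> {1..n}"
      using i X by blast
    then have block: "conn_rel n F `` {i} \<in> beta n F" and self: "i \<in> conn_rel n F `` {i}"
      unfolding beta_def conn_rel_def by (auto intro: quotientI)
    have "\<tau> ` (conn_rel n F `` {i}) = conn_rel n F `` {i}"
      using \<tau> block unfolding young_sub_def by simp
    then have "\<tau> i \<in> conn_rel n F `` {i}"
      using imageI[OF self, of \<tau>] by (simp only:)
    then have "(i, \<tau> i) \<in> (F \<union> F\<inverse>)\<^sup>*"
      unfolding conn_rel_def by blast
    then show ?thesis
      by (induction rule: rtrancl_induct) (use i sat in auto)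
  qed
  moreover have "inj_on \<tau> X"
    using \<tau> unfolding young_sub_def perms_def by (auto intro: permutes_inj_on)
  moreover have "finite X"
    using X finite_subset by blast
  ultimately show ?thesis
    by (meson endo_inj_surj image_subsetI)
qed

text \<open>Connected vertices share a block, so every block contains both or neither and is
  preserved when they are exchanged.\<close>

lemma transpose_in_young_sub:
  assumes "i \<in> {1..n}" "j \<in> {1..n}" and conn: "(i, j) \<in> (F \<union> F\<inverse>)\<^sup>*"
  shows "transpose i j \<in> young_sub n F"
proof -
  have sym: "(j, i) \<in> (F \<union> F\<inverse>)\<^sup>*"
    using conn by (metis converse_Un converse_converse rtrancl_converseI sup_commute)
  have "transpose i j ` B = B" if B: "B \<in> beta n F" for B
  proof -
    obtain k where "B = conn_rel n F `` {k}"
      using B unfolding beta_def by (auto elim: quotientE)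
    then have "i \<in> B \<longleftrightarrow> j \<in> B"
      using assms sym unfolding conn_rel_def by (auto intro: rtrancl_trans)
    then show ?thesis
      by (rule transpose_image_eq)
  qed
  moreover have "transpose i j permutes {1..n}"
    using assms by (intro permutes_swap_id)
  ultimately show ?thesis
    unfolding young_sub_def perms_def by blast
qed

section \<open>Chain groups and linearity of the boundary\<close>

lemma chains_iff:
  "c \<in> chains n E i \<longleftrightarrow>
     (\<forall>F \<sigma>. c F \<sigma> \<noteq> 0 \<longrightarrow> F \<subseteq> E \<and> card F = i \<and> \<sigma> \<in> perms n) \<and>
     (\<forall>F. \<forall>\<sigma>\<in>perms n. \<forall>\<tau>\<in>young_sub n F. c F (\<sigma> \<circ> \<tau>) = c F \<sigma>)"
  unfolding chains_def MF_iff grp_ring_def mem_Collect_eq by blast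

lemma chains_zero: "(\<lambda>F \<sigma>. 0) \<in> chains n E i"
  unfolding chains_iff by simp

lemma chains_scale_add:
  assumes "c \<in> chains n E i" "d \<in> chains n E i"
  shows "(\<lambda>F \<sigma>. s * c F \<sigma> + d F \<sigma>) \<in> chains n E i"
  unfolding chains_iff
proof (intro conjI allI impI ballI)
  fix F \<sigma> assume "s * c F \<sigma> + d F \<sigma> \<noteq> 0"
  then have "c F \<sigma> \<noteq> 0 \<or> d F \<sigma> \<noteq> 0"
    by auto
  then show "F \<subseteq> E" "card F = i" "\<sigma> \<in> perms n"
    using assms unfolding chains_iff by meson+
next
  fix F \<sigma> \<tau> assume "\<sigma> \<in> perms n" "\<tau> \<in> young_sub n F"
  then show "s * c F (\<sigma> \<circ> \<tau>) + d F (\<sigma> \<circ> \<tau>) = s * c F \<sigma> + d F \<sigma>"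
    using assms unfolding chains_iff by simp
qed

lemma bd_scale_add:
  "bd n E i (\<lambda>F \<sigma>. s * c F \<sigma> + d F \<sigma>) F' \<sigma> = s * bd n E i c F' \<sigma> + bd n E i d F' \<sigma>"
  unfolding bd_def by (simp add: algebra_simps sum.distrib sum_distrib_left)

lemma finite_complete_graph: "finite (complete_graph n)"
proof (rule finite_subset)
  show "complete_graph n \<subseteq> {1..n} \<times> {1..n}"
    unfolding complete_graph_def by auto
qed simp

section \<open>Chains given by letter patterns\<close>

datatype letter = A | B | C

text \<open>The boundary commutes with left multiplication by permutations of the values. Chains
  invariant under exchanging 1, 2 and exchanging 3, 4 depend on \<sigma> only through the word of
  the letters \<open>kind (\<sigma> i)\<close>, a rearrangement of AABBC.\<close>

definition kind :: "nat \<Rightarrow> letter" where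
  "kind v = (if v \<in> {1, 2} then A else if v \<in> {3, 4} then B else C)"

type_synonym pattern = "(nat set \<times> letter set) list"

text \<open>On one or two positions the set of letters determines how often each occurs:
  \<open>{B}\<close> on two positions means B twice, \<open>{A, B}\<close> means one of
  each.\<close>

definition matches :: "pattern \<Rightarrow> (nat \<Rightarrow> nat) \<Rightarrow> bool" where
  "matches p \<sigma> \<longleftrightarrow> \<sigma> \<in> perms 5 \<and> (\<forall>(X, S) \<in> set p. kind ` \<sigma> ` X = S)"

definition cell :: "(nat \<times> nat) set \<Rightarrow> pattern \<Rightarrow> (nat \<times> nat) set \<Rightarrow> (nat \<Rightarrow> nat) \<Rightarrow> int" where
  "cell F p = (\<lambda>F' \<sigma>. of_bool (F' = F \<and> matches p \<sigma>))"

definition saturated :: "(nat \<times> nat) set \<Rightarrow> pattern \<Rightarrow> bool" where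
  "saturated F p \<longleftrightarrow>
     (\<forall>(X, S) \<in> set p. X \<subseteq> {1..5} \<and> (\<forall>(i, j) \<in> F. i \<in> X \<longleftrightarrow> j \<in> X))"

definition chain_of :: "(int \<times> (nat \<times> nat) set \<times> pattern) list \<Rightarrow>
    (nat \<times> nat) set \<Rightarrow> (nat \<Rightarrow> nat) \<Rightarrow> int" where
  "chain_of L = (\<lambda>F \<sigma>. \<Sum>(s, F', p)\<leftarrow>L. s * cell F' p F \<sigma>)"

lemma chain_of_Nil: "chain_of [] = (\<lambda>F \<sigma>. 0)"
  and chain_of_Cons: "chain_of ((s, F', p) # L) = (\<lambda>F \<sigma>. s * cell F' p F \<sigma> + chain_of L F \<sigma>)"
  unfolding chain_of_def by simp_all

text \<open>Saturation makes each listed \<open>X\<close> a union of components, so the Young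
  subgroup maps it onto itself and right translation leaves the letters on \<open>X\<close>
  unchanged.\<close>

lemma cell_in_chains:
  assumes "F \<subseteq> E" "card F = i" and sat: "saturated F p"
  shows "cell F p \<in> chains 5 E i"
proof -
  have "matches p (\<sigma> \<circ> \<tau>) \<longleftrightarrow> matches p \<sigma>" if \<sigma>: "\<sigma> \<in> perms 5" and \<tau>: "\<tau> \<in> young_sub 5 F" for \<sigma> \<tau>
  proof -
    have stable: "\<tau> ` X = X" if "(X, S) \<in> set p" for X S
      using that sat unfolding saturated_def by (intro young_sub_image_saturated[OF \<tau>]) auto
    have "kind ` (\<sigma> \<circ> \<tau>) ` X = kind ` \<sigma> ` X" if "(X, S) \<in> set p" for X S
      by (simp only: image_comp[symmetric] stable[OF that])
    moreover have "\<sigma> \<circ> \<tau> \<in> perms 5"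
      using \<sigma> \<tau> young_sub_subset_perms perms_comp by blast
    ultimately show ?thesis
      using \<sigma> unfolding matches_def by (metis (no_types, lifting) case_prodD case_prodI2)
  qed
  moreover have "\<sigma> \<in> perms 5" if "matches p \<sigma>" for \<sigma>
    using that unfolding matches_def by simp
  ultimately show ?thesis
    using assms unfolding chains_iff cell_def by simp
qed

lemma chain_of_in_chains:
  assumes "\<forall>(s, F, p) \<in> set L. F \<subseteq> E \<and> card F = i \<and> saturated F p"
  shows "chain_of L \<in> chains 5 E i"
  using assms
proof (induction L)
  case Nil
  then show ?case
    by (simp add: chain_of_Nil chains_zero)
next
  case (Cons a L)
  obtain s F p where "a = (s, F, p)"
    by (cases a)
  with Cons show ?case
    by (auto simp: chain_of_Cons intro!: chains_scale_add cell_in_chains)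
qed

lemma bd_chain_of:
  "bd 5 E i (chain_of L) F' \<sigma> = (\<Sum>(s, F, p)\<leftarrow>L. s * bd 5 E i (cell F p) F' \<sigma>)"
proof (induction L)
  case Nil
  then show ?case
    by (simp add: chain_of_Nil bd_def)
next
  case (Cons a L)
  then show ?case
    by (cases a) (simp add: chain_of_Cons bd_scale_add)
qed

section \<open>Boundaries of cells on one and two edges\<close>

lemma edge_less_irrefl: "\<not> edge_less e e"
  and edge_less_asym: "edge_less e f \<Longrightarrow> \<not> edge_less f e"
  and edge_less_total: "e \<noteq> f \<Longrightarrow> edge_less e f \<or> edge_less f e"
  unfolding edge_less_def by (auto simp: prod_eq_iff)

lemma bd_cell_singleton:
  assumes "e \<in> complete_graph n"
  shows "bd 5 (complete_graph n) 1 (cell {e} p) F' \<sigma> = of_bool (F' = {} \<and> matches p \<sigma>)"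
proof (cases "F' = {}")
  case True
  have none: "{x. x = f \<and> edge_less x f} = {}" for f
    using edge_less_irrefl by blast
  have "bd 5 (complete_graph n) 1 (cell {e} p) F' \<sigma>
      = (\<Sum>f\<in>complete_graph n. if f = e then of_bool (matches p \<sigma>) else 0)"
    unfolding bd_def cell_def True by (simp add: none) (auto intro!: sum.cong)
  then show ?thesis
    using assms finite_complete_graph True by simp
next
  case False
  \<comment> \<open>The degree condition asks for \<open>card F' = 0\<close>; as a subset of a
    finite graph, \<open>F'\<close> cannot be an infinite set with default cardinality 0, so it
    would have to be empty.\<close>
  then show ?thesis
    unfolding bd_def using finite_complete_graph finite_subset by (auto simp: card_eq_0_iff)
qed

text \<open>Deleting the smaller edge \<open>e\<close> leaves \<open>f\<close> with sign +1;
  deleting \<open>f\<close>, which has \<open>e\<close> before it, leaves \<open>e\<close> with sign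
  -1. The pattern is kept, since the boundary only includes one module into another.\<close>

lemma bd_cell_pair:
  assumes e: "e \<in> complete_graph n" and f: "f \<in> complete_graph n" and less: "edge_less e f"
  shows "bd 5 (complete_graph n) 2 (cell {e, f} p) F' \<sigma>
    = (of_bool (F' = {f}) - of_bool (F' = {e})) * of_bool (matches p \<sigma>)"
proof (cases "\<exists>g \<in> complete_graph n. F' = {g}")
  case True
  then obtain g where g: "g \<in> complete_graph n" "F' = {g}"
    by blast
  have ne: "e \<noteq> f"
    using less edge_less_irrefl by blast
  have sum: "bd 5 (complete_graph n) 2 (cell {e, f} p) F' \<sigma>
      = (\<Sum>h\<in>complete_graph n - {g}. (- 1) ^ card {x \<in> {h, g}. edge_less x h} *
           of_bool ({h, g} = {e, f} \<and> matches p \<sigma>))"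
    unfolding bd_def cell_def using g by simp
  have above: "{x. (x = f \<or> x = e) \<and> edge_less x f} = {e}"
    and below: "{x. (x = e \<or> x = f) \<and> edge_less x e} = {}"
    using less edge_less_irrefl edge_less_asym by blast+
  consider "g = e" | "g = f" | "g \<noteq> e" "g \<noteq> f"
    by blast
  then show ?thesis
  proof cases
    case 1
    have "bd 5 (complete_graph n) 2 (cell {e, f} p) F' \<sigma>
        = (\<Sum>h\<in>complete_graph n - {e}. if h = f then - of_bool (matches p \<sigma>) else 0)"
      unfolding sum 1 using ne by (intro sum.cong) (simp_all add: doubleton_eq_iff above)
    then show ?thesis
      using f ne 1 g finite_complete_graph by simp
  next
    case 2
    have "bd 5 (complete_graph n) 2 (cell {e, f} p) F' \<sigma>
        = (\<Sum>h\<in>complete_graph n - {f}. if h = e then of_bool (matches p \<sigma>) else 0)"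
      unfolding sum 2 using ne by (intro sum.cong) (simp_all add: doubleton_eq_iff below)
    then show ?thesis
      using e ne 2 g finite_complete_graph by simp
  next
    case 3
    then have "{h, g} \<noteq> {e, f}" for h
      by (auto simp: doubleton_eq_iff)
    then show ?thesis
      unfolding sum using 3 g by simp
  qed
next
  case False
  then have "\<not> (F' \<subseteq> complete_graph n \<and> card F' + 1 = 2)" "F' \<noteq> {e}" "F' \<noteq> {f}"
    using e f by (auto simp: card_1_singleton_iff)
  then show ?thesis
    unfolding bd_def by auto
qed

section \<open>The explicit cycle and the filling of its double\<close>

text \<open>Among the rearrangements of AABBC the three patterns select BABAC, AABBC, and both of
  these on the edge (1,4). The boundary forgets the edge, and the words cancel.\<close>

definition torsion_cycle :: "(int \<times> (nat \<times> nat) set \<times> pattern) list" where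
  "torsion_cycle =
    [(-1, {(1, 3)}, [({1, 3}, {B}), ({5}, {C})]),
     (-1, {(3, 4)}, [({3, 4}, {B}), ({5}, {C})]),
     (1, {(1, 4)}, [({1, 4}, {A, B}), ({3}, {B}), ({5}, {C})])]"

text \<open>The two edges are listed separately, smaller first, so that the signs of the boundary
  terms can be read off. Three adjacent pairs at vertex 1 and all fifteen disjoint pairs occur, once
  each; for an adjacent pair the pattern prescribes the letters at the two vertices outside its
  block.\<close>

definition double_filling :: "(int \<times> (nat \<times> nat) \<times> (nat \<times> nat) \<times> pattern) list" where
  "double_filling =
    [(1, (1, 2), (1, 4), [({3}, {B}), ({5}, {C})]),
     (1, (1, 2), (1, 5), [({3}, {B}), ({4}, {C})]),
     (1, (1, 4), (1, 5), [({3}, {B}), ({2}, {C})]),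
     (-1, (1, 2), (3, 4), [({1, 2}, {A}), ({3, 4}, {B})]),
     (-1, (1, 2), (3, 5), [({1, 2}, {A}), ({3, 5}, {B})]),
     (-1, (1, 2), (4, 5), [({1, 2}, {A, B}), ({4, 5}, {A, C})]),
     (-1, (1, 3), (2, 4), [({1, 3}, {B}), ({2, 4}, {A, C})]),
     (1, (1, 3), (2, 5), [({1, 3}, {B}), ({2, 5}, {A, C})]),
     (1, (1, 3), (4, 5), [({1, 3}, {B}), ({4, 5}, {A, C})]),
     (1, (1, 4), (2, 3), [({1, 4}, {A}), ({2, 3}, {B})]),
     (-1, (1, 4), (2, 5), [({1, 4}, {A, B}), ({2, 5}, {A, C})]),
     (-1, (1, 4), (3, 5), [({1, 4}, {A}), ({3, 5}, {B})]),
     (1, (1, 5), (2, 3), [({1, 5}, {A}), ({2, 3}, {B})]),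
     (1, (1, 5), (2, 4), [({1, 5}, {A, B}), ({2, 4}, {A, C})]),
     (1, (1, 5), (3, 4), [({1, 5}, {A}), ({3, 4}, {B})]),
     (1, (2, 3), (4, 5), [({2, 3}, {B}), ({4, 5}, {A, C})]),
     (1, (2, 4), (3, 5), [({2, 4}, {A, C}), ({3, 5}, {B})]),
     (-1, (2, 5), (3, 4), [({2, 5}, {A, C}), ({3, 4}, {B})])]"

lemma torsion_cycle_in_chains: "chain_of torsion_cycle \<in> chains 5 (complete_graph 5) 1"
  by (rule chain_of_in_chains) (simp add: torsion_cycle_def complete_graph_def saturated_def)

definition pair_chain :: "(int \<times> (nat \<times> nat) \<times> (nat \<times> nat) \<times> pattern) list \<Rightarrow>
    (nat \<times> nat) set \<Rightarrow> (nat \<Rightarrow> nat) \<Rightarrow> int" where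
  "pair_chain L = chain_of (map (\<lambda>(s, e, f, p). (s, {e, f}, p)) L)"

lemma double_filling_in_chains: "pair_chain double_filling \<in> chains 5 (complete_graph 5) 2"
  unfolding pair_chain_def
  by (rule chain_of_in_chains) (simp add: double_filling_def complete_graph_def saturated_def)

text \<open>\<sigma> permutes the five values, so its word has the same letter counts as the word
  AABBC of the identity.\<close>

lemma kind_count:
  assumes "\<sigma> \<in> perms 5"
  shows "(\<Sum>i\<in>{1, 2, 3, 4, 5}. of_bool (kind (\<sigma> i) = l)) = (if l = C then 1 else 2 :: nat)"
proof -
  have set: "{1, 2, 3, 4, 5} = {1..5::nat}"
    by auto
  have "(\<Sum>i\<in>{1..5}. of_bool (kind (\<sigma> i) = l)) = (\<Sum>i\<in>{1..5}. of_bool (kind i = l) :: nat)"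
    using sum.permute[of \<sigma> "{1..5}" "\<lambda>i. of_bool (kind i = l) :: nat"] assms
    unfolding perms_def by (simp only: mem_Collect_eq comp_def)
  also have "\<dots> = (\<Sum>i\<in>{1, 2, 3, 4, 5}. of_bool (kind i = l))"
    unfolding set ..
  also have "\<dots> = (if l = C then 1 else 2)"
    by (cases l) (simp_all add: kind_def)
  finally show ?thesis
    unfolding set .
qed

text \<open>In this expanded form the counts eliminate all but 30 of the 243 letter assignments in
  the later case splits; the count of C follows.\<close>

lemma kind_counts:
  assumes "\<sigma> \<in> perms 5"
  shows "of_bool (kind (\<sigma> 1) = A) + (of_bool (kind (\<sigma> 2) = A) + (of_bool (kind (\<sigma> 3) = A)
      + (of_bool (kind (\<sigma> 4) = A) + of_bool (kind (\<sigma> 5) = A)))) = (2 :: nat)"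
    and "of_bool (kind (\<sigma> 1) = B) + (of_bool (kind (\<sigma> 2) = B) + (of_bool (kind (\<sigma> 3) = B)
      + (of_bool (kind (\<sigma> 4) = B) + of_bool (kind (\<sigma> 5) = B)))) = (2 :: nat)"
  using kind_count[OF assms, of A] kind_count[OF assms, of B]
  by (simp_all del: sum_of_bool_eq One_nat_def)

lemma in_complete_graph: "(i, j) \<in> complete_graph n \<longleftrightarrow> 1 \<le> i \<and> i < j \<and> j \<le> n"
  unfolding complete_graph_def by simp

lemma bd_pair_chain:
  assumes "\<forall>(s, e, f, p) \<in> set L. e \<in> complete_graph n \<and> f \<in> complete_graph n \<and> edge_less e f"
  shows "bd 5 (complete_graph n) 2 (pair_chain L) F \<sigma> =
    (\<Sum>(s, e, f, p)\<leftarrow>L. s * ((of_bool (F = {f}) - of_bool (F = {e})) * of_bool (matches p \<sigma>)))"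
  using assms unfolding pair_chain_def bd_chain_of by (induction L) (auto simp: bd_cell_pair)

lemma bd_torsion_cycle: "bd 5 (complete_graph 5) 1 (chain_of torsion_cycle) = (\<lambda>F \<sigma>. 0)"
proof (intro ext)
  fix F \<sigma>
  have sum: "bd 5 (complete_graph 5) 1 (chain_of torsion_cycle) F \<sigma>
      = (\<Sum>(s, F', p)\<leftarrow>torsion_cycle. s * of_bool (F = {} \<and> matches p \<sigma>))"
    unfolding bd_chain_of torsion_cycle_def
    by (simp add: bd_cell_singleton in_complete_graph del: One_nat_def)
  show "bd 5 (complete_graph 5) 1 (chain_of torsion_cycle) F \<sigma> = 0"
  proof (cases "\<sigma> \<in> perms 5")
    case True
    \<comment> \<open>Only the five letters of \<sigma> enter, so the cancellation is checked word
      by word.\<close>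
    from kind_counts[OF True] show ?thesis
      unfolding sum
      by (simp add: torsion_cycle_def matches_def True del: One_nat_def)
        (cases "kind (\<sigma> 1)"; cases "kind (\<sigma> 2)"; cases "kind (\<sigma> 3)"; cases "kind (\<sigma> 4)"; cases "kind (\<sigma> 5)";
          simp add: doubleton_eq_iff del: One_nat_def)
  next
    case False
    then show ?thesis
      unfolding sum by (simp add: torsion_cycle_def matches_def)
  qed
qed

text \<open>The coefficients at distinct edges are independent, so \<open>w\<close> may be arbitrary; this leaves
  one linear identity for each of the 30 words with two \<open>A\<close>s, two \<open>B\<close>s and one \<open>C\<close>.\<close>

lemma double_filling_identity:
  fixes a :: "nat \<Rightarrow> letter" and w :: "(nat \<times> nat) set \<Rightarrow> int"
  assumes "of_bool (a 1 = A) + (of_bool (a 2 = A) + (of_bool (a 3 = A)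
      + (of_bool (a 4 = A) + of_bool (a 5 = A)))) = (2 :: nat)"
    and "of_bool (a 1 = B) + (of_bool (a 2 = B) + (of_bool (a 3 = B)
      + (of_bool (a 4 = B) + of_bool (a 5 = B)))) = (2 :: nat)"
  shows "(\<Sum>(s, e, f, p)\<leftarrow>double_filling. s * ((w {f} - w {e}) * of_bool (\<forall>(X, S) \<in> set p. a ` X = S)))
    = 2 * (\<Sum>(s, F, p)\<leftarrow>torsion_cycle. s * (w F * of_bool (\<forall>(X, S) \<in> set p. a ` X = S)))"
  unfolding double_filling_def torsion_cycle_def using assms
  by (cases "a 1"; cases "a 2"; cases "a 3"; cases "a 4"; cases "a 5";
      simp add: doubleton_eq_iff del: One_nat_def)

lemma bd_double_filling:
  "bd 5 (complete_graph 5) 2 (pair_chain double_filling) = (\<lambda>F \<sigma>. 2 * chain_of torsion_cycle F \<sigma>)"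
proof (intro ext)
  fix F \<sigma>
  have sum: "bd 5 (complete_graph 5) 2 (pair_chain double_filling) F \<sigma> =
    (\<Sum>(s, e, f, p)\<leftarrow>double_filling. s * ((of_bool (F = {f}) - of_bool (F = {e})) * of_bool (matches p \<sigma>)))"
    by (rule bd_pair_chain)
      (simp add: double_filling_def in_complete_graph edge_less_def del: One_nat_def)
  show "bd 5 (complete_graph 5) 2 (pair_chain double_filling) F \<sigma> = 2 * chain_of torsion_cycle F \<sigma>"
  proof (cases "\<sigma> \<in> perms 5")
    case True
    then have "matches p \<sigma> \<longleftrightarrow> (\<forall>(X, S) \<in> set p. (\<lambda>i. kind (\<sigma> i)) ` X = S)" for p
      unfolding matches_def image_image by simp
    \<comment> \<open>Taking for \<open>w\<close> the indicator of the single edge set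
      \<open>F\<close> extracts the coefficient at \<open>F\<close> from the identity.\<close>
    then show ?thesis
      unfolding sum chain_of_def cell_def of_bool_conj
      using double_filling_identity[of "\<lambda>i. kind (\<sigma> i)" "\<lambda>F'. of_bool (F = F')"] kind_counts[OF True]
      by (simp only:)
  next
    case False
    then have "\<not> matches p \<sigma>" for p
      unfolding matches_def by simp
    then show ?thesis
      unfolding sum chain_of_def cell_def by (simp add: case_prod_unfold)
  qed
qed

section \<open>The functional \<Phi> modulo 4 on boundaries\<close>

definition crossing :: "nat \<Rightarrow> nat set \<Rightarrow> nat \<times> nat \<Rightarrow> (nat \<Rightarrow> nat) set" where
  "crossing n Q e = {\<sigma> \<in> perms n. \<sigma> ` {fst e, snd e} = Q}"

text \<open>This is \<Phi> for a fixed \<open>Q\<close>; it sees only the one-edge components of a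
  chain.\<close>

definition crossing_sum :: "nat \<Rightarrow> nat set \<Rightarrow>
    ((nat \<times> nat) set \<Rightarrow> (nat \<Rightarrow> nat) \<Rightarrow> int) \<Rightarrow> int" where
  "crossing_sum n Q c = (\<Sum>e\<in>complete_graph n. \<Sum>\<sigma>\<in>crossing n Q e. c {e} \<sigma>)"

text \<open>The involution \<open>s\<close> exchanges the part of \<open>S\<close> where
  \<open>P\<close> holds with the rest and preserves \<open>g\<close>, so both parts have the same
  sum.\<close>

lemma sum_eq_double_half:
  fixes g :: "'a \<Rightarrow> int"
  assumes "finite S"
    and "\<And>x. x \<in> S \<Longrightarrow> s x \<in> S" "\<And>x. x \<in> S \<Longrightarrow> s (s x) = x"
    and "\<And>x. x \<in> S \<Longrightarrow> g (s x) = g x" "\<And>x. x \<in> S \<Longrightarrow> P (s x) \<longleftrightarrow> \<not> P x"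
  shows "sum g S = 2 * sum g {x \<in> S. P x}"
proof -
  have "sum g {x \<in> S. \<not> P x} = sum g {x \<in> S. P x}"
    by (rule sum.reindex_bij_witness[of _ s s]) (use assms in auto)
  moreover have "sum g S = sum g {x \<in> S. P x} + sum g {x \<in> S. \<not> P x}"
    using assms(1) by (subst sum.union_disjoint[symmetric]) (auto intro: sum.cong)
  ultimately show ?thesis
    by simp
qed

lemma finite_crossing: "finite (crossing n Q e)"
  unfolding crossing_def using finite_perms by simp

text \<open>The transpositions of \<open>i\<close>, \<open>j\<close> and of \<open>k\<close>,
  \<open>l\<close> lie in the Young subgroup, and right translation by either keeps the image of {i,
  j}. Each of them gives one factor 2.\<close>

lemma crossing_sum_disjoint:
  fixes x :: "(nat \<Rightarrow> nat) \<Rightarrow> int"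
  assumes x: "x \<in> MF n {(i, j), (k, l)}"
    and ij: "(i, j) \<in> complete_graph n" and kl: "(k, l) \<in> complete_graph n"
    and disj: "{i, j} \<inter> {k, l} = {}"
  shows "4 dvd sum x (crossing n Q (i, j))"
proof -
  let ?F = "{(i, j), (k, l)}" and ?S = "crossing n Q (i, j)"
  have bounds: "i \<in> {1..n}" "j \<in> {1..n}" "k \<in> {1..n}" "l \<in> {1..n}" "i \<noteq> j" "k \<noteq> l"
    using ij kl unfolding complete_graph_def by auto
  have ij_young: "transpose i j \<in> young_sub n ?F" and kl_young: "transpose k l \<in> young_sub n ?F"
    using bounds by (auto intro!: transpose_in_young_sub)
  have ij_perm: "transpose i j \<in> perms n" and kl_perm: "transpose k l \<in> perms n"
    using ij_young kl_young young_sub_subset_perms by auto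
  have neq: "\<sigma> a \<noteq> \<sigma> b" if "\<sigma> \<in> perms n" "a \<noteq> b" for \<sigma> a b
    using that unfolding perms_def by (auto dest: permutes_inj injD)
  have img_ij: "(\<sigma> \<circ> transpose i j) ` {i, j} = \<sigma> ` {i, j}" for \<sigma> :: "nat \<Rightarrow> nat"
    by auto
  have img_kl: "(\<sigma> \<circ> transpose k l) ` {i, j} = \<sigma> ` {i, j}" for \<sigma> :: "nat \<Rightarrow> nat"
    using disj by (auto simp: transpose_def)
  \<comment> \<open>The order of the values at \<open>i\<close> and \<open>j\<close>, distinct by
    injectivity, singles out one permutation of each pair.\<close>
  have "sum x ?S = 2 * sum x {\<sigma> \<in> ?S. \<sigma> i < \<sigma> j}"
  proof (rule sum_eq_double_half[where s = "\<lambda>\<sigma>. \<sigma> \<circ> transpose i j"])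
    fix \<sigma> assume \<sigma>: "\<sigma> \<in> ?S"
    then show "\<sigma> \<circ> transpose i j \<in> ?S"
      using perms_comp[OF _ ij_perm] img_ij unfolding crossing_def by simp
    show "(\<sigma> \<circ> transpose i j) \<circ> transpose i j = \<sigma>"
      by (simp add: comp_assoc)
    show "x (\<sigma> \<circ> transpose i j) = x \<sigma>"
      using MF_right_invariant[OF x ij_young] .
    show "(\<sigma> \<circ> transpose i j) i < (\<sigma> \<circ> transpose i j) j \<longleftrightarrow> \<not> \<sigma> i < \<sigma> j"
      using neq[of \<sigma> i j] \<sigma> bounds unfolding crossing_def by auto
  qed (rule finite_crossing)
  \<comment> \<open>The second transposition fixes \<open>i\<close> and \<open>j\<close>, so it acts
    on the half already selected.\<close>
  also have "sum x {\<sigma> \<in> ?S. \<sigma> i < \<sigma> j} = 2 * sum x {\<sigma> \<in> {\<sigma> \<in> ?S. \<sigma> i < \<sigma> j}. \<sigma> k < \<sigma> l}"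
  proof (rule sum_eq_double_half[where s = "\<lambda>\<sigma>. \<sigma> \<circ> transpose k l"])
    fix \<sigma> assume \<sigma>: "\<sigma> \<in> {\<sigma> \<in> ?S. \<sigma> i < \<sigma> j}"
    have "(\<sigma> \<circ> transpose k l) i = \<sigma> i" "(\<sigma> \<circ> transpose k l) j = \<sigma> j"
      using disj by (auto simp: transpose_def)
    then show "\<sigma> \<circ> transpose k l \<in> {\<sigma> \<in> ?S. \<sigma> i < \<sigma> j}"
      using \<sigma> perms_comp[OF _ kl_perm] img_kl unfolding crossing_def by simp
    show "(\<sigma> \<circ> transpose k l) \<circ> transpose k l = \<sigma>"
      by (simp add: comp_assoc)
    show "x (\<sigma> \<circ> transpose k l) = x \<sigma>"
      using MF_right_invariant[OF x kl_young] .
    show "(\<sigma> \<circ> transpose k l) k < (\<sigma> \<circ> transpose k l) l \<longleftrightarrow> \<not> \<sigma> k < \<sigma> l"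
      using neq[of \<sigma> k l] \<sigma> bounds unfolding crossing_def by auto
  qed (simp add: finite_crossing)
  finally show ?thesis
    by simp
qed

text \<open>The transposition of the two unshared endpoints exchanges \<open>e\<close> and
  \<open>f\<close> as vertex sets, and it lies in the Young subgroup because the edges join these
  endpoints through the shared vertex. Right translation by it matches the two index sets and keeps
  \<open>x\<close>.\<close>

lemma crossing_sum_adjacent:
  fixes x :: "(nat \<Rightarrow> nat) \<Rightarrow> int"
  assumes x: "x \<in> MF n {e, f}"
    and e: "e \<in> complete_graph n" and f: "f \<in> complete_graph n" and ne: "e \<noteq> f"
    and adj: "{fst e, snd e} \<inter> {fst f, snd f} \<noteq> {}"
  shows "sum x (crossing n Q e) = sum x (crossing n Q f)"
proof -
  \<comment> \<open>\<open>a\<close> is the shared vertex. It may be the smaller or the larger end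
    of either edge, hence the unordered sets.\<close>
  obtain a b c where abc: "{fst e, snd e} = {a, b}" "{fst f, snd f} = {a, c}" "a \<noteq> b" "a \<noteq> c"
    "{a, b, c} \<subseteq> {1..n}" "e = (a, b) \<or> e = (b, a)" "f = (a, c) \<or> f = (c, a)"
  proof -
    obtain i j k l where eq: "e = (i, j)" "f = (k, l)"
      by (metis prod.exhaust)
    have bounds: "1 \<le> i" "i < j" "j \<le> n" "1 \<le> k" "k < l" "l \<le> n"
      using e f unfolding eq complete_graph_def by auto
    consider "i = k" | "i = l" | "j = k" | "j = l"
      using adj unfolding eq by auto
    then show ?thesis
    proof cases
      case 1
      then show ?thesis using bounds by (intro that[of i j l]) (auto simp: eq)
    next
      case 2
      then show ?thesis using bounds by (intro that[of i j k]) (auto simp: eq)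
    next
      case 3
      then show ?thesis using bounds by (intro that[of j i l]) (auto simp: eq)
    next
      case 4
      then show ?thesis using bounds by (intro that[of j i k]) (auto simp: eq)
    qed
  qed
  let ?\<tau> = "transpose b c"
  have "(b, a) \<in> {e, f} \<union> {e, f}\<inverse>" "(a, c) \<in> {e, f} \<union> {e, f}\<inverse>"
    using abc by auto
  then have "(b, c) \<in> ({e, f} \<union> {e, f}\<inverse>)\<^sup>*"
    by (rule converse_rtrancl_into_rtrancl[OF _ r_into_rtrancl])
  then have \<tau>: "?\<tau> \<in> young_sub n {e, f}"
    using abc(5) by (intro transpose_in_young_sub) simp_all
  then have \<tau>p: "?\<tau> \<in> perms n"
    using young_sub_subset_perms by blast
  have "(\<sigma> \<circ> ?\<tau>) ` {a, c} = \<sigma> ` {a, b}" "(\<sigma> \<circ> ?\<tau>) ` {a, b} = \<sigma> ` {a, c}" for \<sigma> :: "nat \<Rightarrow> nat"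
    using abc by (auto simp: transpose_def)
  then show ?thesis
    using perms_comp[OF _ \<tau>p] MF_right_invariant[OF x \<tau>]
    by (intro sum.reindex_bij_witness[of _ "\<lambda>\<sigma>. \<sigma> \<circ> ?\<tau>" "\<lambda>\<sigma>. \<sigma> \<circ> ?\<tau>"])
       (simp_all add: crossing_def abc(1,2) comp_assoc)
qed

lemma crossing_sum_bd:
  assumes c: "c \<in> chains n (complete_graph n) 2"
  shows "4 dvd crossing_sum n Q (bd n (complete_graph n) 2 c)"
proof -
  let ?E = "complete_graph n"
  \<comment> \<open>For distinct edges, \<open>sgn e f\<close> is the sign of the boundary term that
    deletes \<open>f\<close> from \<open>{e, f}\<close>.\<close>
  define sgn :: "nat \<times> nat \<Rightarrow> nat \<times> nat \<Rightarrow> int" where "sgn e f = (if edge_less f e then 1 else - 1)" for e f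
  define G where "G e f = (\<Sum>\<sigma>\<in>crossing n Q e. c {e, f} \<sigma>)" for e f
  define adj where "adj e f \<longleftrightarrow> {fst e, snd e} \<inter> {fst f, snd f} \<noteq> {}" for e f :: "nat \<times> nat"
  have MF: "c F \<in> MF n F" for F
    using c unfolding chains_def by blast
  have sgn: "(- 1) ^ card {x \<in> {f, e}. edge_less x f} = sgn e f" if "e \<noteq> f" for e f
  proof (cases "edge_less f e")
    case True
    then have none: "{x \<in> {f, e}. edge_less x f} = {}"
      using edge_less_irrefl edge_less_asym by blast
    show ?thesis
      unfolding none sgn_def using True by simp
  next
    case False
    then have single: "{x \<in> {f, e}. edge_less x f} = {e}"
      using that edge_less_irrefl edge_less_total by blast
    show ?thesis
      unfolding single sgn_def using False by simp
  qed
  have "bd n ?E 2 c {e} \<sigma> = (\<Sum>f\<in>?E - {e}. sgn e f * c {e, f} \<sigma>)" if "e \<in> ?E" for e \<sigma>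
  proof -
    have "bd n ?E 2 c {e} \<sigma> =
        (\<Sum>f\<in>?E - {e}. (- 1) ^ card {x \<in> {f, e}. edge_less x f} * c {f, e} \<sigma>)"
      using that unfolding bd_def by simp
    also have "\<dots> = (\<Sum>f\<in>?E - {e}. sgn e f * c {e, f} \<sigma>)"
    proof (rule sum.cong[OF refl])
      fix f assume "f \<in> ?E - {e}"
      then have ne: "e \<noteq> f"
        by auto
      show "(- 1) ^ card {x \<in> {f, e}. edge_less x f} * c {f, e} \<sigma> = sgn e f * c {e, f} \<sigma>"
        unfolding sgn[OF ne] by (simp only: insert_commute[of f e])
    qed
    finally show ?thesis .
  qed
  then have "crossing_sum n Q (bd n ?E 2 c) = (\<Sum>e\<in>?E. \<Sum>\<sigma>\<in>crossing n Q e. \<Sum>f\<in>?E - {e}. sgn e f * c {e, f} \<sigma>)"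
    unfolding crossing_sum_def by simp
  also have "\<dots> = (\<Sum>e\<in>?E. \<Sum>f\<in>?E - {e}. sgn e f * G e f)"
    unfolding G_def sum_distrib_left by (intro sum.cong refl sum.swap)
  also have "\<dots> = (\<Sum>(e, f)\<in>Sigma ?E (\<lambda>e. ?E - {e}). sgn e f * G e f)"
    using finite_complete_graph by (simp add: sum.Sigma)
  \<comment> \<open>An edge meets itself, so non-adjacent pairs are distinct and the two sets split
    the ordered pairs of distinct edges.\<close>
  also have "\<dots> = (\<Sum>(e, f)\<in>{(e, f). e \<in> ?E \<and> f \<in> ?E \<and> e \<noteq> f \<and> adj e f}. sgn e f * G e f)
      + (\<Sum>(e, f)\<in>{(e, f). e \<in> ?E \<and> f \<in> ?E \<and> \<not> adj e f}. sgn e f * G e f)" (is "_ = ?a + ?d")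
  proof (subst sum.union_disjoint[symmetric])
    show "finite {(e, f). e \<in> ?E \<and> f \<in> ?E \<and> e \<noteq> f \<and> adj e f}"
      "finite {(e, f). e \<in> ?E \<and> f \<in> ?E \<and> \<not> adj e f}"
      using finite_complete_graph by (auto intro: finite_subset[of _ "?E \<times> ?E"])
  qed (auto simp: adj_def intro!: sum.cong)
  finally have split: "crossing_sum n Q (bd n ?E 2 c) = ?a + ?d" .
  \<comment> \<open>Swapping the edges of an adjacent pair reverses the sign and keeps
    \<open>G\<close>, so the adjacent part equals its own negative.\<close>
  have "?a = (\<Sum>(e, f)\<in>{(e, f). e \<in> ?E \<and> f \<in> ?E \<and> e \<noteq> f \<and> adj e f}. sgn f e * G f e)"
    by (rule sum.reindex_bij_witness[of _ prod.swap prod.swap]) (auto simp: adj_def)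
  also have "\<dots> = (\<Sum>(e, f)\<in>{(e, f). e \<in> ?E \<and> f \<in> ?E \<and> e \<noteq> f \<and> adj e f}. - (sgn e f * G e f))"
  proof (rule sum.cong[OF refl])
    fix x assume "x \<in> {(e, f). e \<in> ?E \<and> f \<in> ?E \<and> e \<noteq> f \<and> adj e f}"
    then obtain e f where x: "x = (e, f)" and ef: "e \<in> ?E" "f \<in> ?E" "e \<noteq> f" "adj e f"
      by blast
    have "sgn f e = - sgn e f"
      unfolding sgn_def using edge_less_asym edge_less_total[OF ef(3)] by auto
    moreover have "G f e = G e f"
      unfolding G_def insert_commute[of f e]
      using crossing_sum_adjacent[OF MF ef(1-3)] ef(4) unfolding adj_def by simp
    ultimately show "(case x of (e, f) \<Rightarrow> sgn f e * G f e) = (case x of (e, f) \<Rightarrow> - (sgn e f * G e f))"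
      unfolding x by simp
  qed
  also have "\<dots> = - ?a"
    by (simp add: sum_negf case_prod_unfold)
  finally have "?a = 0"
    by simp
  moreover have "4 dvd ?d"
  proof (rule dvd_sum, clarify)
    fix i j k l assume ef: "(i, j) \<in> ?E" "(k, l) \<in> ?E" "\<not> adj (i, j) (k, l)"
    then show "4 dvd sgn (i, j) (k, l) * G (i, j) (k, l)"
      unfolding G_def adj_def by (intro dvd_mult crossing_sum_disjoint[OF MF]) auto
  qed
  ultimately show ?thesis
    unfolding split by simp
qed

section \<open>The value of \<Phi> on the cycle\<close>

text \<open>The values 1 and 4 carry the letters A and B, whereas the cells at (1,3) and (3,4)
  demand B at both ends. Only the cell at (1,4) remains, where the identity and the transposition of
  1 and 4 are counted.\<close>

lemma crossing_sum_torsion_cycle: "crossing_sum 5 {1, 4} (chain_of torsion_cycle) = 2"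
proof -
  let ?S = "{\<sigma> \<in> crossing 5 {1, 4} (1, 4). matches [({1, 4}, {A, B}), ({3}, {B}), ({5}, {C})] \<sigma>}"
  have kinds: "kind ` \<sigma> ` {fst e, snd e} = {A, B}" if "\<sigma> \<in> crossing 5 {1, 4} e" for \<sigma> e
  proof -
    have "\<sigma> ` {fst e, snd e} = {1, 4}"
      using that unfolding crossing_def by blast
    moreover have "kind ` {1, 4} = {A, B}"
      by (auto simp: kind_def)
    ultimately show ?thesis
      by (simp only:)
  qed
  have "chain_of torsion_cycle {e} \<sigma> = of_bool (e = (1, 4) \<and> \<sigma> \<in> ?S)"
    if \<sigma>: "\<sigma> \<in> crossing 5 {1, 4} e" for e \<sigma>
  proof -
    have no_match: "\<not> matches (({fst e, snd e}, {B}) # p) \<sigma>" for p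
      using kinds[OF \<sigma>] unfolding matches_def by (auto simp del: image_insert)
    have "\<not> (e = (1, 3) \<and> matches [({1, 3}, {B}), ({5}, {C})] \<sigma>)"
      "\<not> (e = (3, 4) \<and> matches [({3, 4}, {B}), ({5}, {C})] \<sigma>)"
      using no_match by auto
    then show ?thesis
      using \<sigma> unfolding chain_of_def torsion_cycle_def cell_def by auto
  qed
  then have "crossing_sum 5 {1, 4} (chain_of torsion_cycle)
      = (\<Sum>e\<in>complete_graph 5. \<Sum>\<sigma>\<in>crossing 5 {1, 4} e. of_bool (e = (1, 4) \<and> \<sigma> \<in> ?S))"
    unfolding crossing_sum_def by (intro sum.cong) auto
  also have "\<dots> = (\<Sum>e\<in>complete_graph 5. if e = (1, 4) then int (card ?S) else 0)"
    by (intro sum.cong) (auto simp: finite_crossing Int_def)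
  also have "\<dots> = int (card ?S)"
    using finite_complete_graph by (simp add: complete_graph_def)
  also have "?S = {id, transpose 1 4}"
  proof (intro equalityI subsetI)
    fix \<sigma> assume "\<sigma> \<in> ?S"
    then have p: "\<sigma> permutes {1..5}" and img: "\<sigma> ` {1, 4} = {1, 4}"
      and kinds: "kind (\<sigma> 3) = B" "kind (\<sigma> 5) = C"
      unfolding crossing_def matches_def perms_def by auto
    have range: "\<sigma> i \<in> {1, 2, 3, 4, 5}" if "i \<in> {1, 2, 3, 4, 5}" for i
      using permutes_in_image[OF p, of i] that by auto
    have neq: "\<sigma> i \<noteq> \<sigma> j" if "i \<noteq> j" for i j
      using permutes_inj[OF p] that by (auto dest: injD)
    have "\<sigma> 5 = 5"
      using range[of 5] kinds(2) by (auto simp: kind_def)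
    moreover have ends: "\<sigma> 1 = 1 \<and> \<sigma> 4 = 4 \<or> \<sigma> 1 = 4 \<and> \<sigma> 4 = 1"
      using img by (auto simp: doubleton_eq_iff)
    \<comment> \<open>The value 4 is taken at an end of the edge (1,4), which leaves 3 as the only
      value of kind B.\<close>
    moreover have "\<sigma> 3 = 3"
      using range[of 3] kinds(1) neq[of 3 1] neq[of 3 4] ends by (auto simp: kind_def)
    moreover have "\<sigma> 2 = 2"
      using range[of 2] neq[of 2 1] neq[of 2 3] neq[of 2 4] neq[of 2 5] calculation by auto
    moreover have "\<sigma> i = i" if "i \<notin> {1, 2, 3, 4, 5}" for i
      using permutes_not_in[OF p, of i] that by auto
    ultimately have "\<sigma> = (if \<sigma> 1 = 1 then id else transpose 1 4)"
      by (intro ext) (auto simp: transpose_def)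
    then show "\<sigma> \<in> {id, transpose 1 4}"
      by (metis insertCI)
  next
    fix \<sigma> :: "nat \<Rightarrow> nat" assume "\<sigma> \<in> {id, transpose 1 4}"
    moreover have "transpose 1 4 permutes {1..5::nat}"
      by (intro permutes_swap_id) auto
    ultimately show "\<sigma> \<in> ?S"
      unfolding crossing_def matches_def perms_def
      by (auto simp: kind_def permutes_id transpose_def)
  qed
  also have "card {id, transpose 1 4 :: nat \<Rightarrow> nat} = 2"
    by (simp add: fun_eq_iff transpose_def exI[of _ 1])
  finally show ?thesis
    by simp
qed

section \<open>The homology class of order two\<close>

theorem theorem4p1:
  shows "\<exists>z \<in> (chains 5 (complete_graph 5) 1 :: ((nat \<times> nat) set \<Rightarrow> (nat \<Rightarrow> nat) \<Rightarrow> int) set).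
           bd 5 (complete_graph 5) 1 z = (\<lambda>F \<sigma>. 0) \<and>
           z \<notin> bd 5 (complete_graph 5) 2 ` chains 5 (complete_graph 5) 2 \<and>
           (\<lambda>F \<sigma>. 2 * z F \<sigma>) \<in> bd 5 (complete_graph 5) 2 ` chains 5 (complete_graph 5) 2"
proof (intro bexI conjI)
  let ?z = "chain_of torsion_cycle"
  show "?z \<in> chains 5 (complete_graph 5) 1"
    by (rule torsion_cycle_in_chains)
  show "bd 5 (complete_graph 5) 1 ?z = (\<lambda>F \<sigma>. 0)"
    by (rule bd_torsion_cycle)
  \<comment> \<open>\<Phi> is 2 on the cycle, but would be a multiple of 4 on a boundary.\<close>
  show "?z \<notin> bd 5 (complete_graph 5) 2 ` chains 5 (complete_graph 5) 2"
  proof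
    assume "?z \<in> bd 5 (complete_graph 5) 2 ` chains 5 (complete_graph 5) 2"
    then obtain c where "c \<in> chains 5 (complete_graph 5) 2" "?z = bd 5 (complete_graph 5) 2 c"
      by blast
    then have "4 dvd crossing_sum 5 {1, 4} ?z"
      using crossing_sum_bd by simp
    then show False
      unfolding crossing_sum_torsion_cycle by simp
  qed
  show "(\<lambda>F \<sigma>. 2 * ?z F \<sigma>) \<in> bd 5 (complete_graph 5) 2 ` chains 5 (complete_graph 5) 2"
    using double_filling_in_chains bd_double_filling by (metis image_eqI)
qed

end
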